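(* Let $R$ be a commutative ring with identity, let $S$ be a multiplicatively closed subset of $R$, and let $R[[X]]$ be the formal power series ring over $R$. Suppose that $Nil(R[[X]])$ is $S$-decomposable. If $R[[X]]$ is nonnil-$S$-Laskerian, then $R$ has the $S$-SFT property (that is, $R$ is an $S$-SFT ring).
   Context: $S\subseteq R$ is also regarded as a multiplicatively closed subset of $R[[X]]$. For a commutative ring $A$ with identity and a multiplicatively closed subset $S$ of $A$: $Nil(A)$ denotes the nilradical of $A$. An ideal $I$ of $A$ is nonnil if $I\nsubseteq Nil(A)$. $rad(Q)$ denotes the radical of an ideal $Q$. A proper ideal $Q$ of $A$ with $Q\cap S=\emptyset$ is $S$-primary if there exists $s\in S$ such that for all $a,b\in A$, if $ab\in Q$ then $sa\in Q$ or $sb\in rad(Q)$. An ideal $I$ of $A$ with $I\cap S=\emptyset$ is $S$-decomposable if it is a finite intersection of $S$-primary ideals of $A$. $A$ is nonnil-$S$-Laskerian if every nonnil ideal of $A$ disjoint from $S$ is $S$-decomposable. An ideal $I$ of $A$ is $S$-finite if there exist $s\in S$ and a finitely generated ideal $J$ of $A$ with $sI\subseteq J\subseteq I$. An ideal $I$ of $A$ is an $S$-SFT ($S$-strong finite type) ideal if there exist an $S$-finite ideal $F\subseteq I$ of $A$ and $n\in\mathbb{N}$ (a positive integer) such that $x^n\in F$ for each $x\in I$. $A$ is an $S$-SFT ring if all its ideals are $S$-SFT ideals. *)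

theory Defs
  imports "HOL-Computational_Algebra.Formal_Power_Series"
begin

text \<open>Ideals of a commutative ring are its submodules, the ring acting on itself by
  multiplication. The library constants for modules carry the scalar multiplication as an
  explicit argument; the following lemma makes the lemmas of locale \<^locale>\<open>module\<close>
  applicable to them.\<close>

lemma module_times: "module ((*) :: 'a::comm_ring_1 \<Rightarrow> 'a \<Rightarrow> 'a)"
  by unfold_locales (simp_all add: algebra_simps)

definition is_ideal :: "'a::comm_ring_1 set \<Rightarrow> bool" where
  "is_ideal I \<longleftrightarrow> module.subspace (*) I"

definition ideal_gen :: "'a::comm_ring_1 set \<Rightarrow> 'a set" where
  "ideal_gen G = module.span (*) G"

lemma is_ideal_iff:
  "is_ideal I \<longleftrightarrow> 0 \<in> I \<and> (\<forall>x\<in>I. \<forall>y\<in>I. x + y \<in> I) \<and> (\<forall>r. \<forall>x\<in>I. r * x \<in> I)"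
  unfolding is_ideal_def by (rule module.subspace_def[OF module_times])

lemma ideal_gen_eq: "ideal_gen G = {\<Sum>g\<in>F. r g * g | F r. finite F \<and> F \<subseteq> G}"
  unfolding ideal_gen_def by (rule module.span_explicit[OF module_times])

definition mult_closed :: "'a::comm_ring_1 set \<Rightarrow> bool" where
  "mult_closed S \<longleftrightarrow> 1 \<in> S \<and> (\<forall>s\<in>S. \<forall>t\<in>S. s * t \<in> S)"

definition rad :: "'a::comm_ring_1 set \<Rightarrow> 'a set" where
  "rad Q = {a. \<exists>n>0. a ^ n \<in> Q}"

definition Nil_radical :: "'a::comm_ring_1 set" where
  "Nil_radical = {a. \<exists>n>0. a ^ n = 0}"

definition nonnil :: "'a::comm_ring_1 set \<Rightarrow> bool" where
  "nonnil I \<longleftrightarrow> \<not> I \<subseteq> Nil_radical"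

definition S_primary :: "'a::comm_ring_1 set \<Rightarrow> 'a set \<Rightarrow> bool" where
  "S_primary S Q \<longleftrightarrow> is_ideal Q \<and> Q \<noteq> UNIV \<and> Q \<inter> S = {} \<and>
     (\<exists>s\<in>S. \<forall>a b. a * b \<in> Q \<longrightarrow> s * a \<in> Q \<or> s * b \<in> rad Q)"

definition S_decomposable :: "'a::comm_ring_1 set \<Rightarrow> 'a set \<Rightarrow> bool" where
  "S_decomposable S I \<longleftrightarrow> is_ideal I \<and> I \<inter> S = {} \<and>
     (\<exists>\<Q>. finite \<Q> \<and> \<Q> \<noteq> {} \<and> (\<forall>Q\<in>\<Q>. S_primary S Q) \<and> I = \<Inter>\<Q>)"

definition nonnil_S_Laskerian :: "'a::comm_ring_1 set \<Rightarrow> bool" where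
  "nonnil_S_Laskerian S \<longleftrightarrow>
     (\<forall>I. is_ideal I \<and> nonnil I \<and> I \<inter> S = {} \<longrightarrow> S_decomposable S I)"

definition S_finite :: "'a::comm_ring_1 set \<Rightarrow> 'a set \<Rightarrow> bool" where
  "S_finite S I \<longleftrightarrow> is_ideal I \<and>
     (\<exists>s\<in>S. \<exists>G. finite G \<and> (\<forall>x\<in>I. s * x \<in> ideal_gen G) \<and> ideal_gen G \<subseteq> I)"

definition S_SFT_ideal :: "'a::comm_ring_1 set \<Rightarrow> 'a set \<Rightarrow> bool" where
  "S_SFT_ideal S I \<longleftrightarrow> is_ideal I \<and>
     (\<exists>F n. S_finite S F \<and> F \<subseteq> I \<and> n > 0 \<and> (\<forall>x\<in>I. x ^ n \<in> F))"

text \<open>The ring in question is the whole type of the elements of \<open>S\<close>, here and in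
  \<open>nonnil_S_Laskerian\<close>.\<close>

definition S_SFT_ring :: "'a::comm_ring_1 set \<Rightarrow> bool" where
  "S_SFT_ring S \<longleftrightarrow> (\<forall>I. is_ideal I \<longrightarrow> S_SFT_ideal S I)"

end

theory Submission
  imports Defs "HOL-Library.Nat_Bijection"
begin

text \<open>Saturating at \<open>S\<close> makes the constants uniform: if \<open>B\<close> is \<open>S\<close>-decomposable, a single
  \<open>s \<in> S\<close> satisfies \<open>s y \<in> B\<close> whenever \<open>t y \<in> B\<close> for some \<open>t \<in> S\<close>. Applied to the ideal of the
  power series with constant term in \<open>J\<close>, which is nonnil because it contains \<open>X\<close>, this
  gives such an \<open>s\<close> for every ideal \<open>J\<close> of \<open>R\<close> disjoint from \<open>S\<close>. It remains to find a finitely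
  generated \<open>J \<subseteq> I\<close> and an \<open>n > 0\<close> such that each \<open>x \<in> I\<close> has some \<open>s \<in> S\<close> with \<open>s x\<^sup>n \<in> J\<close>.

  Otherwise there are \<open>a\<^sub>0, a\<^sub>1, \<dots> \<in> I\<close> such that no \<open>S\<close>-multiple of a low power of \<open>a\<^sub>i\<close> lies in
  \<open>(a\<^sub>0, \<dots>, a\<^sub>i\<^sub>-\<^sub>1)\<close>. Distribute the \<open>a\<^sub>i\<close> over infinitely many lacunary series \<open>f\<^sub>k\<close>, each having
  infinitely many of them as coefficients. A look at the coefficients shows that no \<open>s f\<^sub>k\<close> is in the
  radical of the ideal \<open>A\<close> generated by the products \<open>f\<^sub>i f\<^sub>j\<close>, \<open>i \<noteq> j\<close>. But if \<open>B\<close> is \<open>A\<close> when \<open>A\<close>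
  is nonnil, and the nilradical when it is not, then \<open>B\<close> has finitely many \<open>S\<close>-primary
  components, and two of the \<open>f\<^sub>k\<close> avoid the radical of the same component although it contains
  their product.\<close>

section \<open>Ideals\<close>

lemma is_ideal_zero: "is_ideal I \<Longrightarrow> 0 \<in> I"
  and is_ideal_add: "is_ideal I \<Longrightarrow> x \<in> I \<Longrightarrow> y \<in> I \<Longrightarrow> x + y \<in> I"
  and is_ideal_mult_left: "is_ideal I \<Longrightarrow> x \<in> I \<Longrightarrow> r * x \<in> I"
  by (auto simp: is_ideal_iff)

lemma is_ideal_mult_right: "is_ideal I \<Longrightarrow> x \<in> I \<Longrightarrow> x * r \<in> I"
  using is_ideal_mult_left[of I x r] by (simp add: mult.commute)

lemma is_ideal_diff: "is_ideal I \<Longrightarrow> x \<in> I \<Longrightarrow> y \<in> I \<Longrightarrow> x - y \<in> I"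
  using is_ideal_add[of I x "- 1 * y"] is_ideal_mult_left[of I y "- 1"] by simp

lemma is_ideal_sum: "is_ideal I \<Longrightarrow> (\<And>x. x \<in> A \<Longrightarrow> f x \<in> I) \<Longrightarrow> sum f A \<in> I"
  by (induction A rule: infinite_finite_induct) (auto intro: is_ideal_zero is_ideal_add)

lemma is_ideal_power_mono:
  assumes "is_ideal I" "r * x ^ m \<in> I" "m \<le> n"
  shows "r * x ^ n \<in> I"
proof -
  have "r * x ^ n = r * x ^ m * x ^ (n - m)"
    using assms(3) by (simp add: mult.assoc flip: power_add)
  then show ?thesis
    using is_ideal_mult_right assms(1,2) by metis
qed

lemma is_ideal_ideal_gen: "is_ideal (ideal_gen G)"
  unfolding is_ideal_def ideal_gen_def by (rule module.subspace_span[OF module_times])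

lemma ideal_gen_superset: "G \<subseteq> ideal_gen G"
  unfolding ideal_gen_def by (rule module.span_superset[OF module_times])

lemma ideal_gen_minimal: "G \<subseteq> I \<Longrightarrow> is_ideal I \<Longrightarrow> ideal_gen G \<subseteq> I"
  unfolding is_ideal_def ideal_gen_def by (rule module.span_minimal[OF module_times])

lemma mult_closed_power: "mult_closed S \<Longrightarrow> s \<in> S \<Longrightarrow> s ^ n \<in> S"
  by (induction n) (auto simp: mult_closed_def)

lemma mult_closed_prod: "mult_closed S \<Longrightarrow> (\<And>x. x \<in> A \<Longrightarrow> f x \<in> S) \<Longrightarrow> prod f A \<in> S"
  by (induction A rule: infinite_finite_induct) (auto simp: mult_closed_def)

lemma mult_closed_fps_const: "mult_closed S \<Longrightarrow> mult_closed (fps_const ` S)"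
  unfolding mult_closed_def by (auto intro: rev_image_eqI[of 1])

section \<open>Decomposable ideals\<close>

text \<open>The product of the finitely many constants serves every component, since each
  \<open>Q\<close> absorbs the remaining factors.\<close>

lemma S_primary_uniform:
  assumes "mult_closed S" "finite \<Q>" "\<And>Q. Q \<in> \<Q> \<Longrightarrow> S_primary S Q"
  obtains s where "s \<in> S"
    and "\<And>Q a b. Q \<in> \<Q> \<Longrightarrow> a * b \<in> Q \<Longrightarrow> s * a \<in> Q \<or> s * b \<in> rad Q"
proof -
  have "\<forall>Q\<in>\<Q>. \<exists>s\<in>S. \<forall>a b. a * b \<in> Q \<longrightarrow> s * a \<in> Q \<or> s * b \<in> rad Q"
    using assms(3) unfolding S_primary_def by blast
  then obtain \<sigma> where \<sigma>: "\<And>Q. Q \<in> \<Q> \<Longrightarrow> \<sigma> Q \<in> S"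
    "\<And>Q a b. Q \<in> \<Q> \<Longrightarrow> a * b \<in> Q \<Longrightarrow> \<sigma> Q * a \<in> Q \<or> \<sigma> Q * b \<in> rad Q"
    by metis
  define s where "s = prod \<sigma> \<Q>"
  show thesis
  proof
    show "s \<in> S"
      unfolding s_def using assms(1) \<sigma>(1) by (rule mult_closed_prod)
  next
    fix Q a b assume Q: "Q \<in> \<Q>" and ab: "a * b \<in> Q"
    have ideal: "is_ideal Q"
      using assms(3)[OF Q] by (simp add: S_primary_def)
    define r where "r = prod \<sigma> (\<Q> - {Q})"
    have s: "s = r * \<sigma> Q"
      unfolding s_def r_def using assms(2) Q by (simp add: prod.remove mult.commute)
    from \<sigma>(2)[OF Q ab] show "s * a \<in> Q \<or> s * b \<in> rad Q"
    proof
      assume "\<sigma> Q * a \<in> Q"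
      then show ?thesis
        using is_ideal_mult_left[OF ideal, of _ r] by (simp add: s mult.assoc)
    next
      assume "\<sigma> Q * b \<in> rad Q"
      then obtain n where "n > 0" "(\<sigma> Q * b) ^ n \<in> Q"
        by (auto simp: rad_def)
      then have "(s * b) ^ n \<in> Q"
        using is_ideal_mult_left[OF ideal, of _ "r ^ n"]
        by (metis s mult.assoc power_mult_distrib)
      then show ?thesis
        using \<open>n > 0\<close> by (auto simp: rad_def)
    qed
  qed
qed

text \<open>If \<open>t * y\<close> is in a component \<open>Q\<close>, then \<open>s * y\<close> is
  in \<open>Q\<close> or \<open>s * t\<close> is in \<open>rad Q\<close>; the latter fails because
  powers of \<open>s * t\<close> stay in \<open>S\<close>, which misses \<open>Q\<close>.\<close>

lemma S_decomposable_saturation: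
  assumes S: "mult_closed S" and B: "S_decomposable S B"
  obtains s where "s \<in> S" and "\<And>t y. t \<in> S \<Longrightarrow> t * y \<in> B \<Longrightarrow> s * y \<in> B"
proof -
  obtain \<Q> where \<Q>: "finite \<Q>" "\<And>Q. Q \<in> \<Q> \<Longrightarrow> S_primary S Q" "B = \<Inter>\<Q>"
    using B unfolding S_decomposable_def by blast
  obtain s where s: "s \<in> S"
    "\<And>Q a b. Q \<in> \<Q> \<Longrightarrow> a * b \<in> Q \<Longrightarrow> s * a \<in> Q \<or> s * b \<in> rad Q"
    using S_primary_uniform[OF S \<Q>(1,2)] by blast
  have "s * y \<in> Q" if "t \<in> S" "t * y \<in> B" "Q \<in> \<Q>" for t y Q
  proof -
    have "s * t \<in> S"
      using S s(1) that(1) by (simp add: mult_closed_def)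
    then have "(s * t) ^ n \<notin> Q" for n
      using mult_closed_power[OF S] \<Q>(2)[OF that(3)] unfolding S_primary_def by blast
    then show ?thesis
      using s(2)[OF that(3), of y t] that \<Q>(3) by (auto simp: rad_def mult.commute)
  qed
  then show thesis
    using that s(1) \<Q>(3) by blast
qed

lemma S_decomposable_orthogonal_seq:
  fixes f :: "nat \<Rightarrow> 'a::comm_ring_1"
  assumes S: "mult_closed S" and B: "S_decomposable S B"
    and orth: "\<And>i j. i \<noteq> j \<Longrightarrow> f i * f j \<in> B"
  obtains s k where "s \<in> S" and "s * f k \<in> rad B"
proof (rule ccontr)
  assume no: "\<not> thesis"
  obtain \<Q> where \<Q>: "finite \<Q>" "\<And>Q. Q \<in> \<Q> \<Longrightarrow> S_primary S Q" "B = \<Inter>\<Q>"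
    using B unfolding S_decomposable_def by blast
  have ideal: "is_ideal Q" if "Q \<in> \<Q>" for Q
    using \<Q>(2)[OF that] by (simp add: S_primary_def)
  obtain s where s: "s \<in> S"
    "\<And>Q a b. Q \<in> \<Q> \<Longrightarrow> a * b \<in> Q \<Longrightarrow> s * a \<in> Q \<or> s * b \<in> rad Q"
    using S_primary_uniform[OF S \<Q>(1,2)] by blast
  have "\<exists>Q\<in>\<Q>. s * f k \<notin> rad Q" for k
  proof (rule ccontr)
    assume "\<not> ?thesis"
    then have "\<forall>Q\<in>\<Q>. \<exists>n>0. (s * f k) ^ n \<in> Q"
      by (auto simp: rad_def)
    then obtain \<nu> where \<nu>: "\<And>Q. Q \<in> \<Q> \<Longrightarrow> (s * f k) ^ \<nu> Q \<in> Q"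
      by metis
    \<comment> \<open>The sum bounds all exponents at once; \<open>Suc\<close> keeps it positive, as
      \<open>rad\<close> requires.\<close>
    have "1 * (s * f k) ^ Suc (sum \<nu> \<Q>) \<in> Q" if "Q \<in> \<Q>" for Q
    proof (rule is_ideal_power_mono[OF ideal[OF that]])
      show "1 * (s * f k) ^ \<nu> Q \<in> Q"
        using \<nu>[OF that] by simp
      show "\<nu> Q \<le> Suc (sum \<nu> \<Q>)"
        using member_le_sum[of Q \<Q> \<nu>] \<Q>(1) that by simp
    qed
    then have "s * f k \<in> rad B"
      unfolding \<Q>(3) rad_def by (auto intro!: exI[of _ "Suc (sum \<nu> \<Q>)"])
    with no s(1) that show False
      by blast
  qed
  then obtain q where q: "\<And>k. q k \<in> \<Q>" "\<And>k. s * f k \<notin> rad (q k)"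
    by metis
  have "\<not> inj q"
    using q(1) \<Q>(1) finite_subset[of "range q" \<Q>] finite_imageD[of q UNIV] by blast
  then obtain i j where ij: "i \<noteq> j" "q i = q j"
    by (auto simp: inj_def)
  have "f i * f j \<in> q i"
    using orth[OF ij(1)] q(1)[of i] \<Q>(3) by blast
  then have "s * f i \<in> q i \<or> s * f j \<in> rad (q i)"
    using s(2) q(1) by blast
  moreover have "q i \<subseteq> rad (q i)"
    unfolding rad_def by (auto intro!: exI[of _ "1::nat"])
  ultimately show False
    using q(2)[of i] q(2)[of j] ij(2) by auto
qed

section \<open>Ideals of power series\<close>

text \<open>The kernel of the map from R[[X]] to (R/J)[X]/(X^d).\<close>

definition fps_low_ideal :: "nat \<Rightarrow> 'a::comm_ring_1 set \<Rightarrow> 'a fps set" where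
  "fps_low_ideal d J = {h. \<forall>m<d. fps_nth h m \<in> J}"

lemma is_ideal_fps_low_ideal:
  assumes "is_ideal J"
  shows "is_ideal (fps_low_ideal d J)"
proof -
  have "fps_nth (r * x) m \<in> J" if "\<forall>m<d. fps_nth x m \<in> J" "m < d" for r x :: "'a fps" and m
    unfolding fps_mult_nth using assms that
    by (intro is_ideal_sum is_ideal_mult_left) auto
  then show ?thesis
    using is_ideal_zero[OF assms] is_ideal_add[OF assms]
    unfolding is_ideal_iff fps_low_ideal_def by auto
qed

lemma nonnil_S_Laskerian_saturation:
  fixes S :: "'a::comm_ring_1 set"
  assumes S: "mult_closed S" and L: "nonnil_S_Laskerian (fps_const ` S)"
    and J: "is_ideal J" "J \<inter> S = {}"
  obtains s where "s \<in> S" and "\<And>t y. t \<in> S \<Longrightarrow> t * y \<in> J \<Longrightarrow> s * y \<in> J"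
proof -
  define A where "A = fps_low_ideal 1 J"
  have const: "fps_const c \<in> A \<longleftrightarrow> c \<in> J" for c
    by (simp add: A_def fps_low_ideal_def)
  have "fps_X \<in> A"
    using is_ideal_zero[OF J(1)] by (simp add: A_def fps_low_ideal_def)
  moreover have "fps_X ^ n \<noteq> (0 :: 'a fps)" for n
    by (metis fps_X_power_nth fps_zero_nth zero_neq_one)
  ultimately have "nonnil A"
    unfolding nonnil_def Nil_radical_def by blast
  moreover have "is_ideal A"
    unfolding A_def by (rule is_ideal_fps_low_ideal[OF J(1)])
  moreover have "A \<inter> fps_const ` S = {}"
    using J(2) const by auto
  ultimately have "S_decomposable (fps_const ` S) A"
    using L by (simp add: nonnil_S_Laskerian_def)
  then obtain s where s: "s \<in> fps_const ` S"
    "\<And>t y. t \<in> fps_const ` S \<Longrightarrow> t * y \<in> A \<Longrightarrow> s * y \<in> A"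
    using S_decomposable_saturation[OF mult_closed_fps_const[OF S]] by blast
  then obtain s' where s': "s' \<in> S" "s = fps_const s'"
    by blast
  have "s' * y \<in> J" if "t \<in> S" "t * y \<in> J" for t y
    using s(2)[of "fps_const t" "fps_const y"] that by (simp add: s' const)
  then show thesis
    using that s'(1) by blast
qed

section \<open>Lacunary series\<close>

text \<open>The sum has at most one term. The shift by \<open>Suc\<close> avoids the collision 0! =
  1!, and factorial gaps leave room for powers: n (i+1)! < (i+2)! for n \<le> i+1.\<close>

definition lacunary :: "(nat \<Rightarrow> 'a::comm_ring_1) \<Rightarrow> nat set \<Rightarrow> 'a fps" where
  "lacunary a N = Abs_fps (\<lambda>m. \<Sum>i | i \<in> N \<and> fact (Suc i) = m. a i)"

text \<open>The premise on \<open>a\<close> keeps \<open>fact (Suc j) = m\<close> so that the index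
  \<open>i\<close> can be discarded either by \<open>i \<notin> N\<close> or by
  \<open>m \<noteq> fact (Suc i)\<close>.\<close>

lemma lacunary_nth_in_ideal:
  assumes J: "is_ideal J" and a: "\<And>j. j \<in> N \<Longrightarrow> j \<le> i \<Longrightarrow> fact (Suc j) = m \<Longrightarrow> a j \<in> J"
    and m: "m < fact (Suc (Suc i))"
  shows "fps_nth (lacunary a N) m \<in> J"
  unfolding lacunary_def fps_nth_Abs_fps
proof (rule is_ideal_sum[OF J])
  fix j assume j: "j \<in> {j. j \<in> N \<and> fact (Suc j) = m}"
  have "j \<le> i"
  proof (rule ccontr)
    assume "\<not> j \<le> i"
    then have "fact (Suc (Suc i)) \<le> (fact (Suc j) :: nat)"
      by (intro fact_mono) auto
    with j m show False
      by simp
  qed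
  with a j show "a j \<in> J"
    by blast
qed

lemma lacunary_nth_fact:
  assumes "i \<in> N"
  shows "fps_nth (lacunary a N) (fact (Suc i)) = a i"
proof -
  have "j = i" if "fact (Suc j) = (fact (Suc i) :: nat)" for j
    using that fact_less_mono[of "Suc i" "Suc j"] fact_less_mono[of "Suc j" "Suc i"]
    by (metis Suc_less_eq less_irrefl linorder_neqE_nat zero_less_Suc)
  then have "{j. j \<in> N \<and> fact (Suc j) = (fact (Suc i) :: nat)} = {i}"
    using assms by blast
  then show ?thesis
    unfolding lacunary_def by (simp del: fact_Suc)
qed

lemma lacunary_in_low_ideal:
  assumes "i \<notin> N"
  shows "lacunary a N \<in> fps_low_ideal (fact (Suc (Suc i))) (ideal_gen (a ` {..<i}))"
  unfolding fps_low_ideal_def mem_Collect_eq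
proof (intro allI impI)
  fix m :: nat assume m: "m < fact (Suc (Suc i))"
  show "fps_nth (lacunary a N) m \<in> ideal_gen (a ` {..<i})"
  proof (rule lacunary_nth_in_ideal[OF is_ideal_ideal_gen _ m])
    fix j assume "j \<in> N" "j \<le> i"
    then have "a j \<in> a ` {..<i}"
      using assms by (cases "j = i") auto
    then show "a j \<in> ideal_gen (a ` {..<i})"
      by (rule subsetD[OF ideal_gen_superset])
  qed
qed

lemma lacunary_diff_in_low_ideal:
  assumes "i \<in> N"
  shows "lacunary a N - fps_const (a i) * fps_X ^ fact (Suc i)
    \<in> fps_low_ideal (fact (Suc (Suc i))) (ideal_gen (a ` {..<i}))"
  unfolding fps_low_ideal_def mem_Collect_eq
proof (intro allI impI)
  fix m :: nat assume m: "m < fact (Suc (Suc i))"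
  show "fps_nth (lacunary a N - fps_const (a i) * fps_X ^ fact (Suc i)) m \<in> ideal_gen (a ` {..<i})"
  proof (cases "m = fact (Suc i)")
    case True
    then show ?thesis
      using lacunary_nth_fact[OF assms, of a] is_ideal_zero[OF is_ideal_ideal_gen]
      by (simp del: fact_Suc)
  next
    case False
    have "fps_nth (lacunary a N) m \<in> ideal_gen (a ` {..<i})"
    proof (rule lacunary_nth_in_ideal[OF is_ideal_ideal_gen _ m])
      fix j assume "j \<in> N" "j \<le> i" "fact (Suc j) = m"
      with False have "a j \<in> a ` {..<i}"
        by (cases "j = i") auto
      then show "a j \<in> ideal_gen (a ` {..<i})"
        by (rule subsetD[OF ideal_gen_superset])
    qed
    with False show ?thesis
      by (simp del: fact_Suc)
  qed
qed

text \<open>Modulo \<open>a\<^sub>0, \<dots>, a\<^sub>i\<^sub>-\<^sub>1\<close> and \<open>X ^ (i + 2)!\<close> the series is the monomial \<open>a\<^sub>i X ^ (i + 1)!\<close>, whose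
  \<open>n\<close>-th power has degree below \<open>(i + 2)!\<close>.\<close>

lemma lacunary_power_in_low_ideal:
  assumes i: "i \<in> N" and n: "n \<le> Suc i"
    and c: "fps_const c * lacunary a N ^ n
      \<in> fps_low_ideal (fact (Suc (Suc i))) (ideal_gen (a ` {..<i}))"
  shows "c * a i ^ n \<in> ideal_gen (a ` {..<i})"
proof -
  define C where "C = fps_low_ideal (fact (Suc (Suc i))) (ideal_gen (a ` {..<i}))"
  have C: "is_ideal C"
    unfolding C_def by (rule is_ideal_fps_low_ideal[OF is_ideal_ideal_gen])
  define f where "f = lacunary a N"
  define g where "g = fps_const (a i) * fps_X ^ fact (Suc i)"
  \<comment> \<open>\<open>f - g\<close> lies in \<open>C\<close> and divides
    \<open>f ^ n - g ^ n\<close>.\<close>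
  have "f ^ n - g ^ n \<in> C"
    unfolding power_diff_sumr2 using lacunary_diff_in_low_ideal[OF i, of a]
    by (intro is_ideal_mult_right[OF C]) (simp add: C_def f_def g_def)
  then have "fps_const c * f ^ n - fps_const c * (f ^ n - g ^ n) \<in> C"
    using c unfolding f_def[symmetric] C_def[symmetric]
    by (blast intro: is_ideal_diff[OF C] is_ideal_mult_left[OF C])
  then have *: "fps_const c * g ^ n \<in> C"
    by (simp add: algebra_simps)
  have "fps_const c * g ^ n = fps_const (c * a i ^ n) * fps_X ^ (fact (Suc i) * n)"
    unfolding g_def power_mult_distrib fps_const_power power_mult
    by (simp only: flip: fps_const_mult mult.assoc)
  then have "fps_nth (fps_const c * g ^ n) (fact (Suc i) * n) = c * a i ^ n"
    by (simp del: fact_Suc)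
  moreover have "fact (Suc i) * n < (fact (Suc (Suc i)) :: nat)"
    using n unfolding fact_Suc[of "Suc i"]
    by (simp add: mult.commute[of "fact (Suc i)"] del: fact_Suc mult_Suc mult_Suc_right)
  ultimately show ?thesis
    using * unfolding C_def fps_low_ideal_def by force
qed

section \<open>The S-SFT property\<close>

lemma not_SFT_sequence:
  fixes S I :: "'a::comm_ring_1 set"
  assumes "\<And>G n. finite G \<Longrightarrow> G \<subseteq> I \<Longrightarrow> n > 0 \<Longrightarrow> \<exists>x\<in>I. \<forall>s\<in>S. s * x ^ n \<notin> ideal_gen G"
  obtains a :: "nat \<Rightarrow> 'a"
  where "\<And>i s. s \<in> S \<Longrightarrow> s * a i ^ Suc i \<notin> ideal_gen (a ` {..<i})"
proof -
  \<comment> \<open>Membership in \<open>I\<close> is part of \<open>P\<close> so that the earlier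
    values are admissible generators for the next choice.\<close>
  define P where "P a i x \<longleftrightarrow> x \<in> I \<and> (\<forall>s\<in>S. s * x ^ Suc i \<notin> ideal_gen (a ` {..<i}))"
    for a :: "nat \<Rightarrow> 'a" and i x
  have "\<exists>a. \<forall>i. P a i (a i)"
  proof (rule dependent_wellorder_choice)
    fix x i and a b :: "nat \<Rightarrow> 'a" assume "\<And>j. j < i \<Longrightarrow> a j = b j"
    then have "a ` {..<i} = b ` {..<i}"
      by auto
    then show "P a i x = P b i x"
      by (simp add: P_def)
  next
    fix i and a :: "nat \<Rightarrow> 'a" assume "\<And>j. j < i \<Longrightarrow> P a j (a j)"
    then have "a ` {..<i} \<subseteq> I"
      by (auto simp: P_def)
    then show "\<exists>x. P a i x"
      using assms[of "a ` {..<i}" "Suc i"] by (auto simp: P_def)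
  qed
  then show thesis
    using that unfolding P_def by blast
qed

text \<open>Here \<open>s\<close> may still depend on \<open>x\<close>; saturating the ideal
  generated by \<open>G\<close> later removes this dependence.\<close>

lemma nonnil_S_Laskerian_pointwise_SFT:
  fixes S I :: "'a::comm_ring_1 set"
  assumes S: "mult_closed S" and N: "S_decomposable (fps_const ` S) (Nil_radical :: 'a fps set)"
    and L: "nonnil_S_Laskerian (fps_const ` S)"
  obtains G n where "finite G" "G \<subseteq> I" "n > 0"
    "\<And>x. x \<in> I \<Longrightarrow> \<exists>s\<in>S. s * x ^ n \<in> ideal_gen G"
proof (rule ccontr)
  assume "\<not> thesis"
  with that have "\<exists>x\<in>I. \<forall>s\<in>S. s * x ^ n \<notin> ideal_gen G" if "finite G" "G \<subseteq> I" "n > 0" for G n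
    using that by meson
  then obtain a :: "nat \<Rightarrow> 'a"
    where a: "\<And>i s. s \<in> S \<Longrightarrow> s * a i ^ Suc i \<notin> ideal_gen (a ` {..<i})"
    using not_SFT_sequence by blast
  \<comment> \<open>The pairing function splits the indices into infinitely many disjoint infinite
    sets.\<close>
  define M where "M k = range (\<lambda>n. prod_encode (k, n))" for k
  define f where "f k = lacunary a (M k)" for k
  define A where "A = ideal_gen {f i * f j | i j. i \<noteq> j}"
  define C where "C i = fps_low_ideal (fact (Suc (Suc i))) (ideal_gen (a ` {..<i}))" for i
  have C: "is_ideal (C i)" for i
    unfolding C_def by (rule is_ideal_fps_low_ideal[OF is_ideal_ideal_gen])
  have A_sub: "A \<subseteq> C i" if "i \<in> M k" for i k
    unfolding A_def
  proof (rule ideal_gen_minimal[OF _ C], safe)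
    fix j l :: nat assume "j \<noteq> l"
    then have "i \<notin> M j \<or> i \<notin> M l"
      using that by (auto simp: M_def)
    then have "f j \<in> C i \<or> f l \<in> C i"
      unfolding C_def f_def using lacunary_in_low_ideal by blast
    then show "f j * f l \<in> C i"
      using is_ideal_mult_left[OF C] is_ideal_mult_right[OF C] by blast
  qed
  have not_rad: "fps_const s * f k ^ n \<notin> A" if "s \<in> S" for s k n
  proof
    assume "fps_const s * f k ^ n \<in> A"
    \<comment> \<open>An index of \<open>M k\<close> that is at least \<open>n\<close>, so that the
      gap after (i+1)! is wide enough for the \<open>n\<close>-th power.\<close>
    define i where "i = prod_encode (k, n)"
    have i: "i \<in> M k" "n \<le> i"
      by (auto simp: i_def M_def le_prod_encode_2)
    then have "fps_const s * f k ^ n \<in> C i"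
      using A_sub \<open>fps_const s * f k ^ n \<in> A\<close> by blast
    then have "s * a i ^ n \<in> ideal_gen (a ` {..<i})"
      using lacunary_power_in_low_ideal[OF i(1), of n s a] i(2) by (simp add: C_def f_def del: fact_Suc)
    then have "s * a i ^ Suc i \<in> ideal_gen (a ` {..<i})"
      using is_ideal_power_mono[OF is_ideal_ideal_gen] i(2) le_SucI by blast
    with a that show False
      by blast
  qed
  have A: "is_ideal A"
    unfolding A_def by (rule is_ideal_ideal_gen)
  have orth: "f i * f j \<in> A" if "i \<noteq> j" for i j
    unfolding A_def using that by (intro subsetD[OF ideal_gen_superset]) blast
  \<comment> \<open>\<open>A \<subseteq> B\<close> makes the \<open>f k\<close> orthogonal modulo
    \<open>B\<close>; \<open>B \<subseteq> rad A\<close> brings the outcome back to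
    \<open>A\<close>, where \<open>not_rad\<close> refutes it.\<close>
  obtain B where B: "S_decomposable (fps_const ` S) B" "A \<subseteq> B" "B \<subseteq> rad A"
  proof (cases "nonnil A")
    case True
    \<comment> \<open>Exponent 0 in \<open>not_rad\<close> says that no constant from
      \<open>S\<close> lies in \<open>A\<close>.\<close>
    have "A \<inter> fps_const ` S = {}"
      using not_rad[of _ 0 0] by auto
    then have "S_decomposable (fps_const ` S) A"
      using L A True by (simp add: nonnil_S_Laskerian_def)
    moreover have "A \<subseteq> rad A"
      unfolding rad_def by (auto intro!: exI[of _ "1::nat"])
    ultimately show thesis
      using that by blast
  next
    case False
    moreover have "Nil_radical \<subseteq> rad A"
      unfolding Nil_radical_def rad_def using is_ideal_zero[OF A] by fastforce
    ultimately show thesis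
      using that N by (auto simp: nonnil_def)
  qed
  obtain s k where "s \<in> fps_const ` S" "s * f k \<in> rad B"
    using S_decomposable_orthogonal_seq[OF mult_closed_fps_const[OF S] B(1), of f] orth B(2) by blast
  then obtain t n where t: "t \<in> S" "(fps_const t * f k) ^ n \<in> B"
    unfolding rad_def by blast
  then obtain m where "((fps_const t * f k) ^ n) ^ m \<in> A"
    using B(3) unfolding rad_def by blast
  then have "fps_const (t ^ (n * m)) * f k ^ (n * m) \<in> A"
    by (simp add: power_mult_distrib flip: power_mult)
  then show False
    using not_rad mult_closed_power[OF S t(1)] by blast
qed

lemma S_SFT_idealI:
  assumes I: "is_ideal I" and s: "s \<in> S" and G: "finite G" "G \<subseteq> I" and n: "n > 0"
    and pow: "\<And>x. x \<in> I \<Longrightarrow> s * x ^ n \<in> ideal_gen G"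
  shows "S_SFT_ideal S I"
proof -
  \<comment> \<open>\<open>F\<close> is enlarged from the ideal generated by \<open>G\<close> just
    enough to contain the powers \<open>x ^ n\<close> themselves, while \<open>s\<close> still maps
    it back.\<close>
  define F where "F = {x \<in> I. s * x \<in> ideal_gen G}"
  note J = is_ideal_ideal_gen[of G]
  have J_sub: "ideal_gen G \<subseteq> I"
    using G(2) I by (rule ideal_gen_minimal)
  have F: "is_ideal F"
    unfolding is_ideal_iff
  proof (intro conjI ballI allI)
    show "0 \<in> F"
      using is_ideal_zero[OF I] is_ideal_zero[OF J] by (simp add: F_def)
    show "x + y \<in> F" if "x \<in> F" "y \<in> F" for x y
      using that is_ideal_add[OF I] is_ideal_add[OF J] by (simp add: F_def distrib_left)
    show "r * x \<in> F" if "x \<in> F" for r x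
      using that is_ideal_mult_left[OF I] is_ideal_mult_left[OF J, of "s * x" r]
      by (simp add: F_def mult.left_commute)
  qed
  have "ideal_gen G \<subseteq> F"
    unfolding F_def using J_sub is_ideal_mult_left[OF J] by blast
  then have "S_finite S F"
    unfolding S_finite_def using F s G(1) by (auto simp: F_def)
  moreover have "x ^ n \<in> F" if "x \<in> I" for x
    using pow[OF that] is_ideal_power_mono[OF I, of 1 x 1 n] that n by (simp add: F_def)
  ultimately show ?thesis
    unfolding S_SFT_ideal_def using I n by (auto simp: F_def intro!: exI[of _ F] exI[of _ n])
qed

theorem proposition2p15:
  fixes S :: "'a::comm_ring_1 set"
  assumes "mult_closed S"
    and "S_decomposable (fps_const ` S) (Nil_radical :: 'a fps set)"
    and "nonnil_S_Laskerian (fps_const ` S)"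
  shows "S_SFT_ring S"
  unfolding S_SFT_ring_def
proof (intro allI impI)
  fix I :: "'a set" assume I: "is_ideal I"
  show "S_SFT_ideal S I"
  proof (cases "I \<inter> S = {}")
    \<comment> \<open>An element \<open>s\<close> of \<open>I\<close> and \<open>S\<close> gives
      \<open>s * x\<close> in the ideal generated by \<open>s\<close>, so exponent 1
      suffices.\<close>
    case False
    then obtain s where s: "s \<in> I" "s \<in> S"
      by blast
    have "s * x ^ 1 \<in> ideal_gen {s}" for x
      using is_ideal_mult_right[OF is_ideal_ideal_gen] ideal_gen_superset[of "{s}"] by auto
    then show ?thesis
      using S_SFT_idealI[OF I s(2), of "{s}" 1] s(1) by simp
  next
    case True
    obtain G n where G: "finite G" "G \<subseteq> I" "n > 0"
      "\<And>x. x \<in> I \<Longrightarrow> \<exists>s\<in>S. s * x ^ n \<in> ideal_gen G"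
      using nonnil_S_Laskerian_pointwise_SFT[OF assms] by blast
    have "ideal_gen G \<inter> S = {}"
      using ideal_gen_minimal[OF G(2) I] True by blast
    then obtain s where "s \<in> S" "\<And>t y. t \<in> S \<Longrightarrow> t * y \<in> ideal_gen G \<Longrightarrow> s * y \<in> ideal_gen G"
      using nonnil_S_Laskerian_saturation[OF assms(1,3) is_ideal_ideal_gen] by blast
    then show ?thesis
      using S_SFT_idealI[OF I _ G(1-3)] G(4) by blast
  qed
qed

end
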